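(* Let $p>3$ be a prime and let $a,b$ be rationals with denominators not divisible by $p$ such that $p\nmid ab$. Then $$\sum_{k=0}^{[p/3]}\binom{3k}k\frac{b^{2k}}{a^k}\equiv(-3a)^{-[p/3]}\,U_{2[p/3]+1}(9b,3a)\pmod p.$$
   Context: $[x]$ is the greatest integer not exceeding $x$. The Lucas sequence $U_n(P,Q)$ is defined by $U_0=0$, $U_1=1$, $U_{n+1}=PU_n-QU_{n-1}$ for $n\ge1$. Congruences mod $p$ are taken in the ring of rationals with denominator prime to $p$, and $p\nmid ab$ means $ab\not\equiv0\pmod p$. *)

theory Defs
  imports Complex_Main "HOL-Computational_Algebra.Primes"
begin

fun lucas_U :: "'a::comm_ring_1 \<Rightarrow> 'a \<Rightarrow> nat \<Rightarrow> 'a" where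
  "lucas_U P Q 0 = 0"
| "lucas_U P Q (Suc 0) = 1"
| "lucas_U P Q (Suc (Suc n)) = P * lucas_U P Q (Suc n) - Q * lucas_U P Q n"

text \<open>The ring of rationals with denominator prime to \<open>p\<close>, for a prime \<open>p\<close>;
  \<^const>\<open>quotient_of\<close> yields the fraction in lowest terms.\<close>

definition p_integers :: "nat \<Rightarrow> rat set" where
  "p_integers p = {x. \<not> int p dvd snd (quotient_of x)}"

text \<open>Both sides are required to lie in that ring, so the negated congruence expresses
  \<open>p \<nmid> x - y\<close> only for \<open>x\<close> and \<open>y\<close> known to be in it.\<close>

definition p_cong :: "nat \<Rightarrow> rat \<Rightarrow> rat \<Rightarrow> bool" where
  "p_cong p x y \<longleftrightarrow> x \<in> p_integers p \<and> y \<in> p_integers p \<and>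
     (\<exists>z \<in> p_integers p. x - y = of_nat p * z)"

end

theory Submission
  imports Defs "HOL-Number_Theory.Cong"
begin

text \<open>Put \<open>n = [p/3]\<close>. Expanding the Lucas sequence as a polynomial in its parameters turns the
  right-hand side into the sum of \<open>(n+k choose 2k) (-27)^k b^(2k)/a^k\<close> over \<open>k \<le> n\<close>, so it
  suffices to compare coefficients. Both \<open>(2k)! (3k choose k)\<close> and \<open>(2k)! (n+k choose 2k) (-27)^k\<close>
  satisfy first-order recurrences in \<open>k\<close>, whose multipliers differ by \<open>3 (3n+1) (3n+2)\<close>, which \<open>p\<close>
  divides; and \<open>(2k)!\<close> is invertible modulo \<open>p\<close> since \<open>2k < p\<close>.\<close>

section \<open>Lucas sequences as polynomials in their parameters\<close>

text \<open>Only the odd case is used later, but the three-term recurrence links both parities, so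
  they are proved together. In each case Pascal's rule merges the two sums.\<close>

lemma lucas_U_odd_even_expansion:
  fixes P Q :: "'a::comm_ring_1"
  shows "lucas_U P Q (2 * n + 1) =
           (\<Sum>k\<le>n. of_nat ((n + k) choose (2 * k)) * P ^ (2 * k) * (- Q) ^ (n - k)) \<and>
         lucas_U P Q (2 * n + 2) =
           (\<Sum>k\<le>n. of_nat ((n + k + 1) choose (2 * k + 1)) * P ^ (2 * k + 1) * (- Q) ^ (n - k))"
proof (induction n)
  case 0
  then show ?case by simp
next
  case (Suc n)
  let ?e = "\<lambda>n k. of_nat ((n + k) choose (2 * k)) * P ^ (2 * k) * (- Q) ^ (n - k)"
  let ?o = "\<lambda>n k. of_nat ((n + k + 1) choose (2 * k + 1)) * P ^ (2 * k + 1) * (- Q) ^ (n - k)"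
  \<comment> \<open>Raising the upper limit to \<open>Suc n\<close> adds only zero: the new
    coefficient is (2n+1 choose 2n+2), and (2n+2 choose 2n+3) in \<open>ext_o\<close>.\<close>
  have ext_e: "(- Q) * (\<Sum>k\<le>n. ?e n k) =
      (\<Sum>k\<le>Suc n. of_nat ((n + k) choose (2 * k)) * P ^ (2 * k) * (- Q) ^ (Suc n - k))"
    by (simp add: sum_distrib_left Suc_diff_le algebra_simps sum_negf binomial_eq_0)
  have ext_o: "(- Q) * (\<Sum>k\<le>n. ?o n k) =
      (\<Sum>k\<le>Suc n. of_nat ((n + k + 1) choose (2 * k + 1)) * P ^ (2 * k + 1) * (- Q) ^ (Suc n - k))"
    by (simp add: sum_distrib_left Suc_diff_le algebra_simps sum_negf binomial_eq_0)
  have "lucas_U P Q (2 * Suc n + 1) =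
      P * lucas_U P Q (2 * n + 2) + (- Q) * lucas_U P Q (2 * n + 1)"
    by simp
  also have "\<dots> = P * (\<Sum>k\<le>n. ?o n k) + (- Q) * (\<Sum>k\<le>n. ?e n k)"
    by (simp only: Suc.IH)
  also have "\<dots> = (\<Sum>k\<le>n. P * ?o n k) +
      (\<Sum>k\<le>Suc n. of_nat ((n + k) choose (2 * k)) * P ^ (2 * k) * (- Q) ^ (Suc n - k))"
    by (simp only: ext_e) (simp only: sum_distrib_left)
  \<comment> \<open>The factor \<open>P\<close> shifts the index by one: term \<open>k\<close> of
    the first sum joins term \<open>Suc k\<close> of the second.\<close>
  also have "\<dots> = (\<Sum>k\<le>Suc n. ?e (Suc n) k)"
    by (simp only: sum.atMost_Suc_shift) (simp add: sum.distrib[symmetric] algebra_simps)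
  finally have odd: "lucas_U P Q (2 * Suc n + 1) = (\<Sum>k\<le>Suc n. ?e (Suc n) k)" .
  have "lucas_U P Q (2 * Suc n + 2) =
      P * lucas_U P Q (2 * Suc n + 1) + (- Q) * lucas_U P Q (2 * n + 2)"
    by simp
  also have "\<dots> = P * (\<Sum>k\<le>Suc n. ?e (Suc n) k) + (- Q) * (\<Sum>k\<le>n. ?o n k)"
    using odd Suc.IH by (simp only:)
  also have "\<dots> = (\<Sum>k\<le>Suc n. ?o (Suc n) k)"
    unfolding ext_o unfolding sum_distrib_left sum.distrib[symmetric]
    by (intro sum.cong refl) (simp add: algebra_simps)
  finally show ?case using odd by blast
qed

section \<open>Recurrences and congruence for the coefficients\<close>

text \<open>The product (2k)! (3k choose k) equals (3k)!/k!. The proof multiplies by the factorial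
  and cancels at the end, which avoids division of naturals.\<close>

lemma fact_times_choose_thrice_Suc:
  "fact (2 * Suc k) * ((3 * Suc k) choose Suc k) =
    3 * (3 * k + 1) * (3 * k + 2) * (fact (2 * k) * ((3 * k) choose k) :: nat)"
proof -
  have fact3: "fact k * (fact (2 * k) * ((3 * k) choose k)) = (fact (3 * k) :: nat)" for k
    using binomial_fact_lemma[of k "3 * k"] by (simp add: mult.assoc)
  have "fact (Suc k) * (fact (2 * Suc k) * ((3 * Suc k) choose Suc k)) = (fact (3 * Suc k) :: nat)"
    by (rule fact3)
  also have "\<dots> = fact (Suc (Suc (Suc (3 * k))))"
    by (rule arg_cong[of _ _ fact]) simp
  also have "\<dots> = (3 * k + 3) * (3 * k + 2) * (3 * k + 1) * fact (3 * k)"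
    by (simp only: fact_Suc of_nat_id) (simp add: algebra_simps)
  also have "\<dots> = fact (Suc k) *
      (3 * (3 * k + 1) * (3 * k + 2) * (fact (2 * k) * ((3 * k) choose k)))"
    unfolding fact3[symmetric] by (simp add: algebra_simps)
  finally show ?thesis
    by (simp only: mult_cancel1 fact_nonzero) simp
qed

text \<open>Here (2k)! (n+k choose 2k) equals (n+k)!/(n-k)!, and \<open>k < n\<close> lets a factor
  \<open>n - k\<close> be split off the denominator.\<close>

lemma fact_times_choose_double_Suc:
  assumes "k < n"
  shows "fact (2 * Suc k) * ((n + Suc k) choose (2 * Suc k)) =
    (n + k + 1) * (n - k) * (fact (2 * k) * ((n + k) choose (2 * k)) :: nat)"
proof -
  have quot: "fact (n - k) * (fact (2 * k) * ((n + k) choose (2 * k))) = (fact (n + k) :: nat)"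
    if "k \<le> n" for k
    using binomial_fact_lemma[of "2 * k" "n + k"] that by (simp add: algebra_simps)
  have "fact (n - Suc k) * (fact (2 * Suc k) * ((n + Suc k) choose (2 * Suc k))) =
      (fact (n + Suc k) :: nat)"
    using assms by (intro quot) simp
  also have "\<dots> = (n + k + 1) * fact (n + k)"
    by simp
  also have "\<dots> = (n + k + 1) * (fact (n - k) * (fact (2 * k) * ((n + k) choose (2 * k))))"
    using quot[of k] assms by simp
  also have "fact (n - k) = (n - k) * (fact (n - Suc k) :: nat)"
    using assms by (metis Suc_diff_Suc fact_Suc of_nat_id)
  finally have "fact (n - Suc k) * (fact (2 * Suc k) * ((n + Suc k) choose (2 * Suc k))) =
      fact (n - Suc k) * ((n + k + 1) * (n - k) * (fact (2 * k) * ((n + k) choose (2 * k))))"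
    by (simp only: ac_simps)
  then show ?thesis
    by (simp only: mult_cancel1 fact_nonzero) simp
qed

lemma cong_fact_times_choose_thrice:
  fixes m :: int
  assumes "m dvd (3 * int n + 1) * (3 * int n + 2)" "k \<le> n"
  shows "[int (fact (2 * k) * ((3 * k) choose k)) =
    (- 27) ^ k * int (fact (2 * k) * ((n + k) choose (2 * k)))] (mod m)"
  using assms(2)
proof (induction k)
  case 0
  then show ?case by simp
next
  case (Suc k)
  let ?t = "\<lambda>k. int (fact (2 * k) * ((3 * k) choose k))"
  let ?d = "\<lambda>k. int (fact (2 * k) * ((n + k) choose (2 * k)))"
  define u where "u = 3 * (3 * int k + 1) * (3 * int k + 2)"
  define v where "v = - 27 * ((int n + int k + 1) * (int n - int k))"
  \<comment> \<open>Here u = 27k(k+1) + 6 and v = 27k(k+1) - 27n(n+1), so the dependence on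
    \<open>k\<close> cancels.\<close>
  have "u - v = 3 * ((3 * int n + 1) * (3 * int n + 2))"
    by (simp add: u_def v_def algebra_simps)
  then have uv: "[u = v] (mod m)"
    using assms(1) by (simp add: cong_iff_dvd_diff)
  have t: "?t (Suc k) = u * ?t k"
    unfolding fact_times_choose_thrice_Suc u_def by (simp add: algebra_simps)
  have "?d (Suc k) = (int n + int k + 1) * (int n - int k) * ?d k"
    using Suc.prems by (subst fact_times_choose_double_Suc) (simp_all add: of_nat_diff ring_distribs)
  then have d: "(- 27) ^ Suc k * ?d (Suc k) = v * ((- 27) ^ k * ?d k)"
    by (simp only: v_def power_Suc ac_simps)
  have "[?t k = (- 27) ^ k * ?d k] (mod m)"
    using Suc by simp
  with uv show ?case
    unfolding t d by (rule cong_mult)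
qed

lemma prime_dvd_choose_thrice_diff:
  fixes p :: nat
  assumes "prime p" "p > 3" "k \<le> p div 3"
  shows "int p dvd int ((3 * k) choose k) - (- 27) ^ k * int ((p div 3 + k) choose (2 * k))"
proof -
  let ?n = "p div 3"
  have "\<not> 3 dvd p"
    using assms primes_dvd_imp_eq[of 3 p] by auto
  \<comment> \<open>The remainder of \<open>p\<close> modulo 3 is 1 or 2, so \<open>p\<close> itself
    is one of the two factors.\<close>
  then have "int p = 3 * int ?n + 1 \<or> int p = 3 * int ?n + 2"
    by presburger
  then have "int p dvd (3 * int ?n + 1) * (3 * int ?n + 2)"
    by (elim disjE) (simp_all only: dvd_triv_left dvd_triv_right)
  from cong_fact_times_choose_thrice[OF this assms(3)]
  have "int p dvd int (fact (2 * k)) *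
      (int ((3 * k) choose k) - (- 27) ^ k * int ((?n + k) choose (2 * k)))"
    by (simp add: cong_iff_dvd_diff algebra_simps)
  moreover have "\<not> int p dvd int (fact (2 * k))"
    using assms by (subst int_dvd_int_iff) (simp add: prime_dvd_fact_iff)
  ultimately show ?thesis
    using assms(1) by (simp add: prime_dvd_mult_iff)
qed

section \<open>Arithmetic of rationals with denominator prime to p\<close>

text \<open>Frees the closure proofs from lowest terms: the reduced denominator divides the
  denominator of any other representation.\<close>

lemma p_integers_iff:
  assumes "prime p"
  shows "x \<in> p_integers p \<longleftrightarrow> (\<exists>u v. x = of_int u / of_int v \<and> \<not> int p dvd v)"
proof
  assume "x \<in> p_integers p"
  then show "\<exists>u v. x = of_int u / of_int v \<and> \<not> int p dvd v"
    unfolding p_integers_def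
    by (metis mem_Collect_eq prod.collapse quotient_of_div)
next
  assume "\<exists>u v. x = of_int u / of_int v \<and> \<not> int p dvd v"
  then obtain u v where uv: "x = of_int u / of_int v" "\<not> int p dvd v" by blast
  obtain c d where cd: "quotient_of x = (c, d)" by fastforce
  have "d > 0" "coprime c d" "x = of_int c / of_int d"
    using cd by (auto dest: quotient_of_denom_pos quotient_of_coprime quotient_of_div)
  moreover have "v \<noteq> 0" using uv by auto
  ultimately have "(of_int (c * v) :: rat) = of_int (u * d)"
    using uv by (simp add: field_simps)
  then have "c * v = u * d" by (simp only: of_int_eq_iff)
  then have "d dvd v"
    using \<open>coprime c d\<close> by (metis coprime_commute coprime_dvd_mult_right_iff dvd_triv_right)
  then show "x \<in> p_integers p"
    using uv cd dvd_trans by (auto simp: p_integers_def)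
qed

context
  fixes p :: nat
  assumes p: "prime p"
begin

lemma p_integers_of_int: "of_int i \<in> p_integers p"
  using p prime_gt_1_nat[OF p] by (simp add: p_integers_def)

lemma p_integers_add:
  assumes "x \<in> p_integers p" "y \<in> p_integers p"
  shows "x + y \<in> p_integers p"
proof -
  obtain u v u' v' where "x = of_int u / of_int v" "\<not> int p dvd v"
      "y = of_int u' / of_int v'" "\<not> int p dvd v'"
    using assms by (auto simp: p_integers_iff[OF p])
  moreover from this have "v \<noteq> 0" "v' \<noteq> 0" by auto
  ultimately have "x + y = of_int (u * v' + u' * v) / of_int (v * v')" "\<not> int p dvd v * v'"
    using p by (auto simp: field_simps prime_dvd_mult_iff)
  then show ?thesis
    unfolding p_integers_iff[OF p] by blast
qed

lemma p_integers_mult: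
  assumes "x \<in> p_integers p" "y \<in> p_integers p"
  shows "x * y \<in> p_integers p"
proof -
  obtain u v u' v' where "x = of_int u / of_int v" "\<not> int p dvd v"
      "y = of_int u' / of_int v'" "\<not> int p dvd v'"
    using assms by (auto simp: p_integers_iff[OF p])
  then have "x * y = of_int (u * u') / of_int (v * v')" "\<not> int p dvd v * v'"
    using p by (auto simp: prime_dvd_mult_iff)
  then show ?thesis
    unfolding p_integers_iff[OF p] by blast
qed

lemma p_integers_power: "x \<in> p_integers p \<Longrightarrow> x ^ k \<in> p_integers p"
  using p_integers_of_int[of 1] by (induction k) (auto intro: p_integers_mult)

lemma p_integers_sum: "(\<And>i. i \<in> A \<Longrightarrow> f i \<in> p_integers p) \<Longrightarrow> sum f A \<in> p_integers p"
  using p_integers_of_int[of 0]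
  by (induction A rule: infinite_finite_induct) (auto intro: p_integers_add)

text \<open>If \<open>p\<close> divided the numerator, \<open>x\<close> would be congruent to 0;
  hence the numerator can serve as a denominator.\<close>

lemma p_integers_inverse:
  assumes "x \<in> p_integers p" "\<not> p_cong p x 0"
  shows "inverse x \<in> p_integers p"
proof -
  obtain u v where uv: "x = of_int u / of_int v" "\<not> int p dvd v"
    using assms by (auto simp: p_integers_iff[OF p])
  have "\<not> int p dvd u"
  proof
    assume "int p dvd u"
    then obtain w where "u = int p * w" ..
    then have "x - 0 = of_nat p * (of_int w / of_int v)"
      using uv by simp
    moreover have "of_int w / of_int v \<in> p_integers p"
      using uv by (auto simp: p_integers_iff[OF p])
    ultimately show False
      using assms p_integers_of_int[of 0] unfolding p_cong_def by auto
  qed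
  moreover have "inverse x = of_int v / of_int u"
    using uv by simp
  ultimately show ?thesis
    unfolding p_integers_iff[OF p] by blast
qed

text \<open>Used in contrapositive form, to pass from p not dividing ab to p not dividing a.\<close>

lemma p_cong_mult_right_zero:
  assumes "p_cong p x 0" "y \<in> p_integers p"
  shows "p_cong p (x * y) 0"
proof -
  obtain z where "x \<in> p_integers p" "z \<in> p_integers p" "x = of_nat p * z"
    using assms by (auto simp: p_cong_def)
  then show ?thesis
    using assms(2) p_integers_of_int[of 0] unfolding p_cong_def
    by (auto intro!: p_integers_mult bexI[of _ "z * y"])
qed

text \<open>Reduces a congruence of sums to divisibility of integer coefficients; the witness
  collects the exact quotients \<open>?q\<close>.\<close>

lemma p_cong_sum_int_coeffs:
  assumes "\<And>k. k \<in> A \<Longrightarrow> int p dvd c k - d k" "\<And>k. k \<in> A \<Longrightarrow> x k \<in> p_integers p"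
  shows "p_cong p (\<Sum>k\<in>A. of_int (c k) * x k) (\<Sum>k\<in>A. of_int (d k) * x k)"
proof -
  let ?q = "\<lambda>k. (c k - d k) div int p"
  have "(\<Sum>k\<in>A. of_int (c k) * x k) - (\<Sum>k\<in>A. of_int (d k) * x k) =
      (\<Sum>k\<in>A. of_int (c k - d k) * x k)"
    by (simp add: sum_subtractf algebra_simps)
  also have "\<dots> = (\<Sum>k\<in>A. of_int (int p * ?q k) * x k)"
    using assms(1) by (intro sum.cong refl) (simp only: dvd_mult_div_cancel)
  also have "\<dots> = of_nat p * (\<Sum>k\<in>A. of_int (?q k) * x k)"
    by (simp add: sum_distrib_left mult.assoc)
  finally show ?thesis
    using assms(2) unfolding p_cong_def
    by (auto intro!: p_integers_sum p_integers_mult p_integers_of_int)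
qed

end

theorem theorem3p1:
  fixes p :: nat and a b :: rat
  assumes "prime p" and "p > 3"
    and "a \<in> p_integers p" and "b \<in> p_integers p"
    and "\<not> p_cong p (a * b) 0"
  shows "p_cong p
    (\<Sum>k = 0..p div 3. of_nat ((3 * k) choose k) * (b ^ (2 * k) / a ^ k))
    ((- 3 * a) powi (- int (p div 3)) * lucas_U (9 * b) (3 * a) (2 * (p div 3) + 1))"
proof -
  define n where "n = p div 3"
  have a_unit: "\<not> p_cong p a 0"
    using p_cong_mult_right_zero assms by blast
  then have "inverse a \<in> p_integers p"
    using assms p_integers_inverse by blast
  have "a \<noteq> 0"
    using a_unit p_integers_of_int[OF assms(1), of 0] by (auto simp: p_cong_def)
  have expand: "(- 3 * a) powi (- int n) * lucas_U (9 * b) (3 * a) (2 * n + 1) =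
      (\<Sum>k\<le>n. of_int ((- 27) ^ k * int ((n + k) choose (2 * k))) * (b ^ (2 * k) / a ^ k))"
  proof -
    have "(- 3 * a) powi (- int n) *
          (of_nat ((n + k) choose (2 * k)) * (9 * b) ^ (2 * k) * (- (3 * a)) ^ (n - k)) =
        of_int ((- 27) ^ k * int ((n + k) choose (2 * k))) * (b ^ (2 * k) / a ^ k)"
      if "k \<le> n" for k
    proof -
      have "(- (3 * a)) ^ n = (- (3 * a)) ^ (n - k) * (- (3 * a)) ^ k"
        using that by (simp flip: power_add)
      \<comment> \<open>The prefactor cancels the power of \<open>- Q\<close> from the expansion, so
        what remains no longer depends on \<open>n\<close>.\<close>
      then have absorb: "(- 3 * a) powi (- int n) * (- (3 * a)) ^ (n - k) = 1 / (- (3 * a)) ^ k"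
        using \<open>a \<noteq> 0\<close> by (simp add: power_int_minus field_simps)
      have "(- 3 * a) powi (- int n) * (of_nat ((n + k) choose (2 * k)) *
          (9 * b) ^ (2 * k) * (- (3 * a)) ^ (n - k)) =
          of_nat ((n + k) choose (2 * k)) *
            ((9 * b) ^ (2 * k) * ((- 3 * a) powi (- int n) * (- (3 * a)) ^ (n - k)))"
        by (simp only: ac_simps)
      also have "\<dots> = of_nat ((n + k) choose (2 * k)) * ((9 * b) ^ (2 * k) / (- (3 * a)) ^ k)"
        unfolding absorb by simp
      also have "(9 * b) ^ (2 * k) / (- (3 * a)) ^ k = (- 27) ^ k * (b ^ (2 * k) / a ^ k)"
      proof -
        have "(9 * b) ^ (2 * k) / (- (3 * a)) ^ k = ((9 * b) ^ 2 / (- (3 * a))) ^ k"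
          by (simp only: power_mult power_divide)
        \<comment> \<open>The constant -27 of the coefficient congruence arises here, as
          81/(-3).\<close>
        also have "(9 * b) ^ 2 / (- (3 * a)) = - 27 * (b ^ 2 / a)"
          using \<open>a \<noteq> 0\<close> by (simp add: field_simps power2_eq_square)
        finally show ?thesis
          by (simp only: power_mult power_divide power_mult_distrib)
      qed
      finally show ?thesis
        by simp
    qed
    then show ?thesis
      unfolding lucas_U_odd_even_expansion[THEN conjunct1] sum_distrib_left
      by (intro sum.cong) auto
  qed
  have "p_cong p (\<Sum>k\<le>n. of_int (int ((3 * k) choose k)) * (b ^ (2 * k) / a ^ k))
      (\<Sum>k\<le>n. of_int ((- 27) ^ k * int ((n + k) choose (2 * k))) * (b ^ (2 * k) / a ^ k))"
  proof (rule p_cong_sum_int_coeffs[OF assms(1)])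
    fix k assume "k \<in> {..n}"
    then show "int p dvd int ((3 * k) choose k) - (- 27) ^ k * int ((n + k) choose (2 * k))"
      unfolding n_def using assms(1,2) by (intro prime_dvd_choose_thrice_diff) auto
    have "b ^ (2 * k) / a ^ k = b ^ (2 * k) * inverse a ^ k"
      by (simp add: divide_inverse power_inverse)
    then show "b ^ (2 * k) / a ^ k \<in> p_integers p"
      using assms \<open>inverse a \<in> p_integers p\<close>
      by (simp only: p_integers_mult p_integers_power)
  qed
  then show ?thesis
    unfolding n_def[symmetric] expand by (simp add: atLeast0AtMost)
qed

end
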